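(* Let $h$ be upper semicontinuous on $\Omega\cup\Gamma_N$ and let $u\in C(\Omega\cup\Gamma_N)$ be a viscosity subsolution of the system $$-\Delta_\infty u-\beta|Du|= h \text{ in }\Omega,\qquad D_\nu u=0\text{ on }\Gamma_N.$$ Then for every $\varepsilon>0$, $$a^+_\varepsilon(\beta)\,S^-_\varepsilon u^\varepsilon(x)-a^-_\varepsilon(\beta)\,S^+_\varepsilon u^\varepsilon(x)\le h^{2\varepsilon}(x)\qquad\text{for every }x\in\Omega_{2\varepsilon}.$$
   Context: Standing setting: $\Omega\subseteq\mathbb{R}^n$ is a bounded, open, connected set with $C^1$ boundary; $\nu$ is the outward unit normal to $\partial\Omega$. For some open set $A\subseteq\mathbb{R}^n$, $\Gamma_N:=\partial\Omega\cap A$ and $\Gamma_D:=\partial\Omega\setminus A$, and $\Gamma_D\neq\emptyset$. If $\Gamma_N\neq\emptyset$, $\Omega$ is assumed convex. $\beta\in\mathbb{R}$ is fixed. For $\varphi\in C^2$: $\Delta_\infty^+\varphi(x):=|D\varphi(x)|^{-2}\langle D^2\varphi(x)D\varphi(x),D\varphi(x)\rangle$ if $D\varphi(x)\ne0$, and $\Delta_\infty^+\varphi(x):=\max\{\langle D^2\varphi(x)v,v\rangle:|v|=1\}$ if $D\varphi(x)=0$. Viscosity subsolution: for $h$ upper semicontinuous on $\Omega\cup\Gamma_N$, an upper semicontinuous $u$ is a viscosity subsolution of the system if for every $\varphi\in C^2(\bar\Omega)$ and every $x_0\in\Omega\cup\Gamma_N$ at which $u-\varphi$ has a local maximum (relative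 to $\bar\Omega$), either $-\Delta^+_\infty\varphi(x_0)-\beta|D\varphi(x_0)|\le h(x_0)$, or $x_0\in\Gamma_N$ and $D\varphi(x_0)\cdot\nu(x_0)\le 0$. Notation: $\Omega_\varepsilon:=\{x\in\bar\Omega:\operatorname{dist}(x,\Gamma_D)>\varepsilon\}$. For a function $w$ and $x\in\Omega_\varepsilon$, $w^\varepsilon(x):=\max_{\bar B(x,\varepsilon)\cap\bar\Omega}w$ and $w_\varepsilon(x):=\min_{\bar B(x,\varepsilon)\cap\bar\Omega}w$; $S^+_\varepsilon w(x):=\frac1\varepsilon(w^\varepsilon(x)-w(x))$, $S^-_\varepsilon w(x):=\frac1\varepsilon(w(x)-w_\varepsilon(x))$. Coefficients: for $\beta\neq0$, $a^+_\varepsilon(\beta):=\frac{\beta}{e^{\varepsilon\beta}-1}$, $a^-_\varepsilon(\beta):=\frac{\beta}{1-e^{-\varepsilon\beta}}$; $a^\pm_\varepsilon(0):=1/\varepsilon$. *)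

theory Defs
  imports "HOL-Analysis.Analysis"
begin

definition grad :: "('a::euclidean_space \<Rightarrow> real) \<Rightarrow> 'a \<Rightarrow> 'a" where
  "grad f x = (\<Sum>b\<in>Basis. frechet_derivative f (at x) b *\<^sub>R b)"

definition hess :: "('a::euclidean_space \<Rightarrow> real) \<Rightarrow> 'a \<Rightarrow> 'a \<Rightarrow> 'a" where
  "hess f x = frechet_derivative (grad f) (at x)"

definition C1_on :: "'a::euclidean_space set \<Rightarrow> ('a \<Rightarrow> real) \<Rightarrow> bool" where
  "C1_on U f \<longleftrightarrow> (\<forall>x\<in>U. f differentiable (at x)) \<and> continuous_on U (grad f)"

definition C2_on :: "'a::euclidean_space set \<Rightarrow> ('a \<Rightarrow> real) \<Rightarrow> bool" where
  "C2_on U f \<longleftrightarrow> (\<forall>x\<in>U. f differentiable (at x)) \<and> (\<forall>x\<in>U. grad f differentiable (at x))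
      \<and> (\<forall>v. continuous_on U (\<lambda>x. hess f x v))"

definition C2_closure :: "'a::euclidean_space set \<Rightarrow> ('a \<Rightarrow> real) \<Rightarrow> bool" where
  "C2_closure \<Omega> f \<longleftrightarrow> (\<exists>U. open U \<and> closure \<Omega> \<subseteq> U \<and> C2_on U f)"

text \<open>Omega has C^1 boundary and nu is its outward unit normal on the boundary:
  locally Omega is the strict sublevel set of a C^1 function with nonvanishing gradient,
  and nu is the normalized gradient of such a local defining function.\<close>
definition C1_boundary_with_normal :: "'a::euclidean_space set \<Rightarrow> ('a \<Rightarrow> 'a) \<Rightarrow> bool" where
  "C1_boundary_with_normal \<Omega> \<nu> \<longleftrightarrow>
     (\<forall>x0\<in>frontier \<Omega>. \<exists>r>0. \<exists>\<rho>. C1_on (ball x0 r) \<rho>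
        \<and> (\<forall>x\<in>ball x0 r. grad \<rho> x \<noteq> 0)
        \<and> \<Omega> \<inter> ball x0 r = {x\<in>ball x0 r. \<rho> x < 0}
        \<and> (\<forall>x\<in>frontier \<Omega> \<inter> ball x0 r. \<nu> x = grad \<rho> x /\<^sub>R norm (grad \<rho> x)))"

definition usc_on :: "'a::metric_space set \<Rightarrow> ('a \<Rightarrow> real) \<Rightarrow> bool" where
  "usc_on S h \<longleftrightarrow> (\<forall>x\<in>S. \<forall>t. h x < t \<longrightarrow> (\<forall>\<^sub>F y in at x within S. h y < t))"

definition inf_lap_plus :: "('a::euclidean_space \<Rightarrow> real) \<Rightarrow> 'a \<Rightarrow> real" where
  "inf_lap_plus \<phi> x =
     (if grad \<phi> x \<noteq> 0
      then (hess \<phi> x (grad \<phi> x) \<bullet> grad \<phi> x) / (norm (grad \<phi> x))\<^sup>2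
      else (SUP v\<in>sphere 0 1. hess \<phi> x v \<bullet> v))"

definition GammaN :: "'a::euclidean_space set \<Rightarrow> 'a set \<Rightarrow> 'a set" where
  "GammaN \<Omega> A = frontier \<Omega> \<inter> A"

definition GammaD :: "'a::euclidean_space set \<Rightarrow> 'a set \<Rightarrow> 'a set" where
  "GammaD \<Omega> A = frontier \<Omega> - A"

definition visc_subsolution ::
  "'a::euclidean_space set \<Rightarrow> 'a set \<Rightarrow> ('a \<Rightarrow> 'a) \<Rightarrow> real \<Rightarrow> ('a \<Rightarrow> real) \<Rightarrow> ('a \<Rightarrow> real) \<Rightarrow> bool" where
  "visc_subsolution \<Omega> A \<nu> \<beta> h u \<longleftrightarrow>
     usc_on (\<Omega> \<union> GammaN \<Omega> A) u \<and>
     (\<forall>\<phi> x0. C2_closure \<Omega> \<phi> \<and> x0 \<in> \<Omega> \<union> GammaN \<Omega> A \<and>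
        (\<exists>r>0. \<forall>y\<in>(\<Omega> \<union> GammaN \<Omega> A) \<inter> ball x0 r. u y - \<phi> y \<le> u x0 - \<phi> x0)
      \<longrightarrow> (- inf_lap_plus \<phi> x0 - \<beta> * norm (grad \<phi> x0) \<le> h x0
           \<or> (x0 \<in> GammaN \<Omega> A \<and> grad \<phi> x0 \<bullet> \<nu> x0 \<le> 0)))"

definition Omega_eps :: "'a::euclidean_space set \<Rightarrow> 'a set \<Rightarrow> real \<Rightarrow> 'a set" where
  "Omega_eps \<Omega> A \<epsilon> = {x\<in>closure \<Omega>. infdist x (GammaD \<Omega> A) > \<epsilon>}"

definition sup_eps :: "'a::euclidean_space set \<Rightarrow> real \<Rightarrow> ('a \<Rightarrow> real) \<Rightarrow> 'a \<Rightarrow> real" where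
  "sup_eps \<Omega> \<epsilon> w x = (SUP y\<in>cball x \<epsilon> \<inter> closure \<Omega>. w y)"

definition inf_eps :: "'a::euclidean_space set \<Rightarrow> real \<Rightarrow> ('a \<Rightarrow> real) \<Rightarrow> 'a \<Rightarrow> real" where
  "inf_eps \<Omega> \<epsilon> w x = (INF y\<in>cball x \<epsilon> \<inter> closure \<Omega>. w y)"

definition S_plus :: "'a::euclidean_space set \<Rightarrow> real \<Rightarrow> ('a \<Rightarrow> real) \<Rightarrow> 'a \<Rightarrow> real" where
  "S_plus \<Omega> \<epsilon> w x = (sup_eps \<Omega> \<epsilon> w x - w x) / \<epsilon>"

definition S_minus :: "'a::euclidean_space set \<Rightarrow> real \<Rightarrow> ('a \<Rightarrow> real) \<Rightarrow> 'a \<Rightarrow> real" where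
  "S_minus \<Omega> \<epsilon> w x = (w x - inf_eps \<Omega> \<epsilon> w x) / \<epsilon>"

definition a_plus :: "real \<Rightarrow> real \<Rightarrow> real" where
  "a_plus \<epsilon> \<beta> = (if \<beta> = 0 then 1 / \<epsilon> else \<beta> / (exp (\<epsilon> * \<beta>) - 1))"

definition a_minus :: "real \<Rightarrow> real \<Rightarrow> real" where
  "a_minus \<epsilon> \<beta> = (if \<beta> = 0 then 1 / \<epsilon> else \<beta> / (1 - exp (- (\<epsilon> * \<beta>))))"

end

(* The profile g with g'' + beta g' = -h0, g(0) = u(x) and g(2 eps) = max of u over the ball of
   radius 2 eps lies above u radially about x.  Since u^eps is at least u(x) on the eps-ball, and
   its maximum there is the maximum of u over the 2 eps-ball by convexity, this comparison at
   radius eps is the claim: the coefficients a^+ and a^- are the ones turning the second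
   difference of g into h0.  The comparison is made about poles in the open set Omega and then
   passed to the limit x, because for an interior pole the convexity of Omega gives a strictly
   positive normal derivative on the Neumann part. *)

theory Submission
  imports Defs
begin

section \<open>Test functions: a second derivative criterion and radial polynomials\<close>

text \<open>As \<open>p1\<close> vanishes at \<open>r\<close> with positive derivative, it is
  negative just to the left of \<open>r\<close> and positive just to the right, so the mean value
  theorem keeps \<open>p\<close> above \<open>p r\<close>. Only differentiability of
  \<open>p1\<close> at the single point \<open>r\<close> is asked for.\<close>

lemma second_derivative_local_min:
  fixes p p1 :: "real \<Rightarrow> real"
  assumes d: "0 < d" and p: "\<And>t. \<bar>t - r\<bar> < d \<Longrightarrow> (p has_real_derivative p1 t) (at t)"
    and p1: "(p1 has_real_derivative l) (at r)" and "p1 r = 0" "0 < l"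
  shows "\<exists>e>0. \<forall>t. \<bar>t - r\<bar> < e \<longrightarrow> p r \<le> p t"
proof -
  obtain e1 where e1: "e1 > 0" "\<And>k. 0 < k \<Longrightarrow> k < e1 \<Longrightarrow> p1 r < p1 (r + k)"
    using DERIV_pos_inc_right[OF p1 \<open>0 < l\<close>] by blast
  obtain e2 where e2: "e2 > 0" "\<And>k. 0 < k \<Longrightarrow> k < e2 \<Longrightarrow> p1 (r - k) < p1 r"
    using DERIV_pos_inc_left[OF p1 \<open>0 < l\<close>] by blast
  define e where "e = min d (min e1 e2)"
  have "p r \<le> p t" if t: "\<bar>t - r\<bar> < e" for t
  proof -
    consider "t = r" | "r < t" | "t < r" by linarith
    then show ?thesis
    proof cases
      case 2
      obtain z where z: "r < z" "z < t" "p t - p r = (t - r) * p1 z"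
        using MVT2[OF 2, of p p1] p t e_def by (smt (verit) min_less_iff_conj)
      then have "0 < p1 z" using e1(2)[of "z - r"] t e_def \<open>p1 r = 0\<close> by auto
      then show ?thesis using z 2 by (smt (verit) mult_pos_pos)
    next
      case 3
      obtain z where z: "t < z" "z < r" "p r - p t = (r - t) * p1 z"
        using MVT2[OF 3, of p p1] p t e_def by (smt (verit) min_less_iff_conj)
      then have "p1 z < 0" using e2(2)[of "r - z"] t e_def \<open>p1 r = 0\<close> by auto
      then show ?thesis using z 3 by (smt (verit) mult_pos_neg)
    qed simp
  qed
  moreover have "e > 0" using d e1 e2 by (simp add: e_def)
  ultimately show ?thesis by blast
qed

lemma grad_eqI:
  assumes "(f has_derivative (\<lambda>v. v \<bullet> G)) (at x)"
  shows "grad f x = G"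
  unfolding grad_def frechet_derivative_at[OF assms, symmetric]
  using euclidean_representation[of G] by (simp add: inner_commute)

text \<open>Being a polynomial in the squared distance, it is smooth even at the pole
  \<open>z\<close>. With \<open>s\<close> the square of a positive radius, \<open>b\<close> sets the
  first radial derivative there and \<open>c\<close> then adjusts the second.\<close>

definition radial_quartic :: "'a::euclidean_space \<Rightarrow> real \<Rightarrow> real \<Rightarrow> real \<Rightarrow> 'a \<Rightarrow> real" where
  "radial_quartic z s b c w = b * ((norm (w - z))\<^sup>2 - s) + c * ((norm (w - z))\<^sup>2 - s)\<^sup>2"

lemma radial_quartic_has_derivative:
  "(radial_quartic z s b c has_derivative
     (\<lambda>v. v \<bullet> ((2 * b + 4 * c * ((norm (x - z))\<^sup>2 - s)) *\<^sub>R (x - z)))) (at x)"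
  unfolding radial_quartic_def power2_norm_eq_inner
  by (rule derivative_eq_intros refl)+
     (auto simp: fun_eq_iff algebra_simps inner_commute power2_eq_square)

lemma grad_radial_quartic:
  "grad (radial_quartic z s b c) x = (2 * b + 4 * c * ((norm (x - z))\<^sup>2 - s)) *\<^sub>R (x - z)"
  by (rule grad_eqI[OF radial_quartic_has_derivative])

lemma grad_radial_quartic_has_derivative:
  "(grad (radial_quartic z s b c) has_derivative
     (\<lambda>v. (2 * b + 4 * c * ((norm (x - z))\<^sup>2 - s)) *\<^sub>R v
        + (8 * c * ((x - z) \<bullet> v)) *\<^sub>R (x - z))) (at x)"
  unfolding grad_radial_quartic[abs_def] power2_norm_eq_inner
  by (rule derivative_eq_intros refl)+
     (auto simp: fun_eq_iff algebra_simps inner_commute simp flip: scaleR_add_left)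

lemma hess_radial_quartic:
  "hess (radial_quartic z s b c) x v = (2 * b + 4 * c * ((norm (x - z))\<^sup>2 - s)) *\<^sub>R v
        + (8 * c * ((x - z) \<bullet> v)) *\<^sub>R (x - z)"
  unfolding hess_def
  by (simp add: frechet_derivative_at[OF grad_radial_quartic_has_derivative, symmetric])

lemma C2_closure_radial_quartic: "C2_closure \<Omega> (radial_quartic z s b c)"
  unfolding C2_closure_def C2_on_def hess_radial_quartic
  by (intro exI[of _ UNIV])
     (auto intro!: continuous_intros differentiableI[OF radial_quartic_has_derivative]
       differentiableI[OF grad_radial_quartic_has_derivative])

text \<open>On the sphere of radius \<open>r\<close> the gradient is radial and nonzero, so the
  operator is the second radial derivative of \<open>b * (t^2 - r^2) + c * (t^2 - r^2)^2\<close> at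
  \<open>t = r\<close>.\<close>

lemma inf_lap_plus_radial_quartic:
  assumes "norm (x - z) = r" "0 < r" "0 < b"
  shows "inf_lap_plus (radial_quartic z (r\<^sup>2) b c) x = 2 * b + 8 * c * r\<^sup>2"
proof -
  have xz: "(x - z) \<bullet> (x - z) = r\<^sup>2" using assms by (simp add: power2_norm_eq_inner[symmetric])
  have g: "grad (radial_quartic z (r\<^sup>2) b c) x = (2 * b) *\<^sub>R (x - z)"
    using assms by (simp add: grad_radial_quartic)
  have "x \<noteq> z" using assms by auto
  then show ?thesis
    unfolding inf_lap_plus_def g hess_radial_quartic
    using assms by (simp add: xz inner_add_left power_mult_distrib) (simp add: field_simps power2_eq_square)
qed

text \<open>At the pole the gradient vanishes, so the supremum branch applies; the Hessian is
  \<open>2 * b\<close> times the identity, and all unit vectors give the same value.\<close>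

lemma inf_lap_plus_quadratic: "inf_lap_plus (radial_quartic z 0 b 0) z = 2 * b"
proof -
  have "(\<lambda>v. hess (radial_quartic z 0 b 0) z v \<bullet> v) ` sphere 0 1 = {2 * b}"
  proof -
    obtain i :: 'a where "i \<in> Basis" using nonempty_Basis by blast
    then have "i \<in> sphere 0 1" by simp
    moreover have "hess (radial_quartic z 0 b 0) z v \<bullet> v = 2 * b" if "v \<in> sphere 0 1" for v
      using that by (simp add: hess_radial_quartic norm_eq_1)
    ultimately show ?thesis by (metis (no_types, lifting) image_cong image_constant)
  qed
  then show ?thesis by (simp add: inf_lap_plus_def grad_radial_quartic)
qed

section \<open>Convexity and the outward normal\<close>

text \<open>The tangent hyperplane at \<open>w\<close> supports the convex set, which gives the weak
  inequality; openness makes it strict. This is what excludes the Neumann alternative for functions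
  increasing radially about an interior pole.\<close>

lemma convex_normal_pos:
  assumes om: "open \<Omega>" "convex \<Omega>" "C1_boundary_with_normal \<Omega> \<nu>"
    and w: "w \<in> frontier \<Omega>" and z: "z \<in> \<Omega>"
  shows "0 < (w - z) \<bullet> \<nu> w"
proof -
  obtain r \<rho> where r: "r > 0" and \<rho>: "C1_on (ball w r) \<rho>" "\<forall>x\<in>ball w r. grad \<rho> x \<noteq> 0"
    "\<Omega> \<inter> ball w r = {x\<in>ball w r. \<rho> x < 0}"
    "\<forall>x\<in>frontier \<Omega> \<inter> ball w r. \<nu> x = grad \<rho> x /\<^sub>R norm (grad \<rho> x)"
    using om(3) w unfolding C1_boundary_with_normal_def by blast
  define G where "G = grad \<rho> w"
  have G: "G \<noteq> 0" and \<nu>: "\<nu> w = G /\<^sub>R norm G" using \<rho> r w by (auto simp: G_def)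
  have "w \<notin> \<Omega>" using w om(1) by (auto simp: frontier_def interior_open)
  then have \<rho>w: "0 \<le> \<rho> w" using \<rho>(3) r by force
  have "\<rho> differentiable (at w)" using \<rho>(1) r by (simp add: C1_on_def)
  then have D: "(\<rho> has_derivative frechet_derivative \<rho> (at w)) (at w)"
    by (simp add: frechet_derivative_works)
  have GD: "frechet_derivative \<rho> (at w) v = v \<bullet> G" for v
  proof -
    interpret linear "frechet_derivative \<rho> (at w)" using D by (rule has_derivative_linear)
    have "frechet_derivative \<rho> (at w) v = frechet_derivative \<rho> (at w) (\<Sum>b\<in>Basis. (v \<bullet> b) *\<^sub>R b)"
      by (simp add: euclidean_representation)
    also have "\<dots> = v \<bullet> G"
      by (simp add: sum scale G_def grad_def inner_sum_right mult.commute)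
    finally show ?thesis .
  qed
  \<comment> \<open>Otherwise \<open>\<rho>\<close> would increase from
    \<open>\<rho> w \<ge> 0\<close> along the segment towards \<open>y\<close>, although by
    convexity that segment enters the set where \<open>\<rho> < 0\<close> at once.\<close>
  have le: "(y - w) \<bullet> G \<le> 0" if y: "y \<in> \<Omega>" for y
  proof (rule ccontr)
    assume "\<not> ?thesis"
    then have pos: "0 < (y - w) \<bullet> G" by simp
    have 1: "((\<lambda>t. w + t *\<^sub>R (y - w)) has_derivative (\<lambda>t. t *\<^sub>R (y - w))) (at 0)"
      by (auto intro!: derivative_eq_intros)
    have 2: "(\<rho> has_derivative (\<lambda>v. v \<bullet> G)) (at (w + 0 *\<^sub>R (y - w)))"
      using D by (simp add: GD[abs_def])
    have "((\<lambda>t. \<rho> (w + t *\<^sub>R (y - w))) has_derivative (\<lambda>t. (t *\<^sub>R (y - w)) \<bullet> G)) (at 0)"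
      using has_derivative_compose[OF 1 2] .
    then have "((\<lambda>t. \<rho> (w + t *\<^sub>R (y - w))) has_real_derivative ((y - w) \<bullet> G)) (at 0)"
      unfolding has_field_derivative_def by (rule has_derivative_eq_rhs) (simp add: fun_eq_iff)
    from DERIV_pos_inc_right[OF this pos] obtain d where d: "d > 0"
      "\<And>t. 0 < t \<Longrightarrow> t < d \<Longrightarrow> \<rho> w < \<rho> (w + t *\<^sub>R (y - w))" by auto
    have yw: "0 < norm (y - w)" using \<open>w \<notin> \<Omega>\<close> y by auto
    define t where "t = min (1/2) (min (d/2) (r / (2 * norm (y - w))))"
    have t: "0 < t" "t < d" "t \<le> 1" "t * norm (y - w) < r"
    proof -
      show "0 < t" "t < d" "t \<le> 1" using d r yw by (auto simp: t_def)
      have "t * norm (y - w) \<le> r / (2 * norm (y - w)) * norm (y - w)"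
        by (intro mult_right_mono) (auto simp: t_def)
      also have "\<dots> < r" using yw r by simp
      finally show "t * norm (y - w) < r" .
    qed
    have "w - t *\<^sub>R (w - y) \<in> interior \<Omega>"
      using w y t om by (intro mem_interior_closure_convex_shrink)
         (auto simp: interior_open frontier_def)
    moreover have "w - t *\<^sub>R (w - y) = w + t *\<^sub>R (y - w)" by (simp add: algebra_simps)
    ultimately have "w + t *\<^sub>R (y - w) \<in> \<Omega> \<inter> ball w r"
      using t om(1) by (auto simp: interior_open dist_norm)
    then have "\<rho> (w + t *\<^sub>R (y - w)) < 0" using \<rho>(3) by blast
    then show False using d(2)[of t] t \<rho>w by linarith
  qed
  obtain e where e: "e > 0" "ball z e \<subseteq> \<Omega>" using om(1) z open_contains_ball by blast
  \<comment> \<open>Pushing \<open>z\<close> a distance \<open>e / 2\<close> along \<open>G\<close>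
    stays in the open set and gains a strictly positive amount.\<close>
  have "z + (e / 2 / norm G) *\<^sub>R G \<in> \<Omega>" using e G by (intro subsetD[OF e(2)]) (auto simp: dist_norm)
  from le[OF this] have "(w - z) \<bullet> G \<ge> (e / 2 / norm G) * (G \<bullet> G)"
    by (simp add: algebra_simps)
  moreover have "(e / 2 / norm G) * (G \<bullet> G) > 0" using e G by simp
  ultimately have "(w - z) \<bullet> G > 0" by linarith
  then show ?thesis using G by (simp add: \<nu>)
qed

section \<open>Comparison with strict radial supersolutions\<close>

text \<open>A radial function is singular at its pole, while test functions must be \<open>C\<^sup>2\<close> on the whole closure;
  at the touching point it is therefore replaced by a polynomial in the squared distance with a
  slightly larger second derivative.\<close>

lemma radial_comparison:
  fixes \<Omega> A :: "'a::euclidean_space set"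
  assumes om: "open \<Omega>" "C1_boundary_with_normal \<Omega> \<nu>" "GammaN \<Omega> A \<noteq> {} \<Longrightarrow> convex \<Omega>"
    and u: "continuous_on (\<Omega> \<union> GammaN \<Omega> A) u" "visc_subsolution \<Omega> A \<nu> \<beta> h u"
    and z: "z \<in> \<Omega>" and R: "0 < R"
    and sub: "cball z R \<inter> closure \<Omega> \<subseteq> \<Omega> \<union> GammaN \<Omega> A"
    and h: "\<And>w. w \<in> cball z R \<inter> closure \<Omega> \<Longrightarrow> h w \<le> h0"
    and g: "\<And>t. (g has_real_derivative g1 t) (at t)" "\<And>t. (g1 has_real_derivative g2 t) (at t)"
    and pos: "\<And>t. 0 < t \<Longrightarrow> t < R \<Longrightarrow> 0 < g1 t"
    and super: "\<And>t. 0 < t \<Longrightarrow> t < R \<Longrightarrow> h0 < - g2 t - \<beta> * g1 t"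
    and bd: "u z \<le> g 0" "\<And>w. w \<in> cball z R \<inter> closure \<Omega> \<Longrightarrow> u w \<le> g R"
    and w: "w \<in> cball z R \<inter> closure \<Omega>"
  shows "u w \<le> g (norm (w - z))"
proof -
  let ?C = "cball z R \<inter> closure \<Omega>"
  have "continuous_on UNIV g" using g(1) by (meson DERIV_isCont continuous_at_imp_continuous_on)
  then have "continuous_on ?C (\<lambda>w. u w - g (norm (w - z)))"
    by (intro continuous_intros continuous_on_subset[OF u(1) sub])
       (auto intro!: continuous_on_compose2[of UNIV g] continuous_intros)
  moreover have "compact ?C" by (simp add: compact_Int_closed)
  ultimately obtain w0 where w0: "w0 \<in> ?C"
    "\<And>y. y \<in> ?C \<Longrightarrow> u y - g (norm (y - z)) \<le> u w0 - g (norm (w0 - z))"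
    using continuous_attains_sup[of ?C] w by blast
  define r where "r = norm (w0 - z)"
  have "u w0 \<le> g r"
  proof (rule ccontr)
    assume neg: "\<not> ?thesis"
    have "r \<noteq> 0" using neg bd(1) by (auto simp: r_def)
    moreover have "r \<noteq> R" using neg bd(2)[OF w0(1)] by auto
    ultimately have r: "0 < r" "r < R" using w0(1) by (auto simp: r_def dist_norm norm_minus_commute)
    \<comment> \<open>The constants give the quartic radial derivative \<open>g1 r\<close> and
      second radial derivative \<open>g2 r + l\<close> at \<open>r\<close>. Here \<open>l\<close> is
      half the gap in the strict inequality \<open>super\<close>, so the other half remains for the
      contradiction.\<close>
    define b where "b = g1 r / (2 * r)"
    have b: "b > 0" using pos r by (simp add: b_def)
    define l where "l = (- g2 r - \<beta> * g1 r - h0) / 2"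
    have l: "l > 0" using super[OF r] by (simp add: l_def)
    define c where "c = (g2 r + l - 2 * b) / (8 * r\<^sup>2)"
    have c: "2 * b + 8 * c * r\<^sup>2 = g2 r + l" using r unfolding c_def by (simp add: field_simps del: distrib_left_numeral right_diff_distrib_numeral)
    let ?\<phi> = "radial_quartic z (r\<^sup>2) b c"
    define p where "p t = b * (t\<^sup>2 - r\<^sup>2) + c * (t\<^sup>2 - r\<^sup>2)\<^sup>2 - g t" for t
    define p1 where "p1 t = 2 * b * t + 4 * c * t * (t\<^sup>2 - r\<^sup>2) - g1 t" for t
    have "(p has_real_derivative p1 t) (at t)" for t
      unfolding p_def p1_def
      by (auto intro!: derivative_eq_intros g simp: algebra_simps)
    moreover have "(p1 has_real_derivative l) (at r)"
    proof -
      have "(p1 has_real_derivative 2 * b + 8 * c * r\<^sup>2 - g2 r) (at r)"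
        unfolding p1_def
        by (auto intro!: derivative_eq_intros g simp: algebra_simps power2_eq_square)
      then show ?thesis using c by simp
    qed
    moreover have "p1 r = 0" using r by (simp add: p1_def b_def)
    ultimately obtain e where e: "e > 0" "\<And>t. \<bar>t - r\<bar> < e \<Longrightarrow> p r \<le> p t"
      using second_derivative_local_min[of 1 r p p1 l] l by auto
    have grad: "grad ?\<phi> w0 = (2 * b) *\<^sub>R (w0 - z)"
      by (simp add: grad_radial_quartic r_def)
    have w0': "w0 \<in> \<Omega> \<union> GammaN \<Omega> A" using w0 sub by blast
    \<comment> \<open>\<open>u - g\<close> is maximal at \<open>w0\<close>, and \<open>p\<close>,
      the quartic minus \<open>g\<close>, is locally minimal at radius \<open>r\<close>. The bound
      \<open>R - r\<close> keeps \<open>y\<close> in the ball where \<open>w0\<close> is the maximum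
      point.\<close>
    have "u y - ?\<phi> y \<le> u w0 - ?\<phi> w0"
      if y: "y \<in> (\<Omega> \<union> GammaN \<Omega> A) \<inter> ball w0 (min e (R - r))" for y
    proof -
      have 1: "\<bar>norm (y - z) - r\<bar> \<le> norm (y - w0)"
        unfolding r_def using norm_triangle_ineq3[of "y - z" "w0 - z"] by simp
      have yw: "norm (y - w0) < min e (R - r)" using y by (auto simp: dist_norm norm_minus_commute)
      have "y \<in> ?C"
        using 1 yw y closure_subset[of \<Omega>]
        by (auto simp: GammaN_def frontier_def dist_norm norm_minus_commute)
      from w0(2)[OF this] have "u y - g (norm (y - z)) \<le> u w0 - g r" by (simp add: r_def)
      moreover have "p r \<le> p (norm (y - z))" using 1 yw by (intro e) linarith
      ultimately show ?thesis by (simp add: p_def radial_quartic_def flip: r_def)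
    qed
    moreover have "min e (R - r) > 0" using e r by simp
    ultimately have *: "- inf_lap_plus ?\<phi> w0 - \<beta> * norm (grad ?\<phi> w0) \<le> h w0
           \<or> (w0 \<in> GammaN \<Omega> A \<and> grad ?\<phi> w0 \<bullet> \<nu> w0 \<le> 0)"
      using u(2) w0' C2_closure_radial_quartic[of \<Omega> z "r\<^sup>2" b c]
      unfolding visc_subsolution_def by blast
    have "\<not> grad ?\<phi> w0 \<bullet> \<nu> w0 \<le> 0" if w0N: "w0 \<in> GammaN \<Omega> A"
    proof -
      have "convex \<Omega>" "w0 \<in> frontier \<Omega>" using om(3) w0N by (auto simp: GammaN_def)
      then have "0 < (w0 - z) \<bullet> \<nu> w0" using convex_normal_pos om(1,2) z by blast
      then show ?thesis using b by (simp add: grad not_le)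
    qed
    with * have "- inf_lap_plus ?\<phi> w0 - \<beta> * norm (grad ?\<phi> w0) \<le> h w0" by blast
    moreover have "norm (grad ?\<phi> w0) = g1 r"
      using b r by (simp add: grad flip: r_def) (simp add: b_def)
    ultimately have "- (g2 r + l) - \<beta> * g1 r \<le> h w0"
      using inf_lap_plus_radial_quartic[of w0 z r b c] r b c by (simp add: r_def[symmetric])
    \<comment> \<open>By the choice of \<open>l\<close> the left side equals \<open>h0 + l\<close>,
      while \<open>h w0 \<le> h0\<close>.\<close>
    then show False using h[OF w0(1)] l by (simp add: l_def field_simps)
  qed
  then show ?thesis using w0(2)[OF w] by (simp add: r_def)
qed

section \<open>One-dimensional profiles\<close>

text \<open>The solution \<open>E\<close> of \<open>E'' + \<beta> E' = 0\<close> with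
  \<open>E(0) = 0\<close> and \<open>E'(0) = 1\<close>; the case \<open>\<beta> = 0\<close> is the
  limit of the formula.\<close>

definition exp_profile :: "real \<Rightarrow> real \<Rightarrow> real" where
  "exp_profile \<beta> r = (if \<beta> = 0 then r else (1 - exp (- (\<beta> * r))) / \<beta>)"

text \<open>The primitive \<open>F\<close> of \<open>E\<close> vanishing at 0, which solves
  \<open>F'' + \<beta> F' = 1\<close>.\<close>

definition exp_profile_int :: "real \<Rightarrow> real \<Rightarrow> real" where
  "exp_profile_int \<beta> r = (if \<beta> = 0 then r\<^sup>2 / 2 else (r - exp_profile \<beta> r) / \<beta>)"

lemma exp_profile_0 [simp]: "exp_profile \<beta> 0 = 0" "exp_profile_int \<beta> 0 = 0"
  by (simp_all add: exp_profile_def exp_profile_int_def)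

lemma mult_exp_profile: "\<beta> * exp_profile \<beta> r = 1 - exp (- (\<beta> * r))"
  by (simp add: exp_profile_def)

text \<open>Allows the factor \<open>exp (- (\<beta> * r))\<close> to be split off the derivative of
  a profile, leaving a monotone factor that carries its sign.\<close>

lemma exp_profile_uminus: "exp_profile \<beta> r = exp (- (\<beta> * r)) * exp_profile (- \<beta>) r"
  by (simp add: exp_profile_def field_simps exp_minus)

lemma exp_profile_has_derivative:
  "(exp_profile \<beta> has_real_derivative exp (- (\<beta> * r))) (at r)"
  unfolding exp_profile_def by (cases "\<beta> = 0") (auto intro!: derivative_eq_intros)

lemma exp_profile_int_has_derivative:
  "(exp_profile_int \<beta> has_real_derivative exp_profile \<beta> r) (at r)"
proof (cases "\<beta> = 0")
  case True
  then show ?thesis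
    unfolding exp_profile_int_def by (auto intro!: derivative_eq_intros simp: exp_profile_def)
next
  case False
  then show ?thesis
    unfolding exp_profile_int_def
    by (auto intro!: derivative_eq_intros exp_profile_has_derivative simp: mult_exp_profile[symmetric])
qed

lemma exp_profile_less: "s < t \<Longrightarrow> exp_profile \<beta> s < exp_profile \<beta> t"
  by (erule DERIV_pos_imp_increasing) (use exp_profile_has_derivative exp_gt_zero in blast)

lemma exp_profile_pos: "0 < r \<Longrightarrow> 0 < exp_profile \<beta> r"
  using exp_profile_less[of 0 r] by simp

lemma exp_profile_int_pos:
  assumes "0 < r" shows "0 < exp_profile_int \<beta> r"
proof -
  have "continuous_on {0..r} (exp_profile_int \<beta>)"
    using exp_profile_int_has_derivative by (meson DERIV_isCont continuous_at_imp_continuous_on)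
  moreover have "\<exists>y. (exp_profile_int \<beta> has_real_derivative y) (at x) \<and> 0 < y" if "0 < x" for x
    using exp_profile_pos[OF that] exp_profile_int_has_derivative by blast
  \<comment> \<open>The derivative vanishes at 0, hence the monotonicity criterion that asks for
    positivity only in the open interval.\<close>
  ultimately have "exp_profile_int \<beta> 0 < exp_profile_int \<beta> r"
    using DERIV_pos_imp_increasing_open[OF assms] by blast
  then show ?thesis by simp
qed

lemma isCont_exp_profile: "isCont (exp_profile \<beta>) r" "isCont (exp_profile_int \<beta>) r"
  using exp_profile_has_derivative exp_profile_int_has_derivative by (blast intro: DERIV_isCont)+

section \<open>Comparison with the profiles\<close>

text \<open>The profile \<open>g = u z + \<sigma> E - H F\<close> solves \<open>g'' + \<beta> g' = -H\<close>. If it stops increasing at some radius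
  \<open>\<rho> < R\<close>, then \<open>M \<le> g R \<le> g \<rho>\<close>, so the comparison can be made on the smaller ball of radius \<open>\<rho>\<close>.\<close>

lemma profile_comparison:
  fixes \<Omega> A :: "'a::euclidean_space set"
  assumes om: "open \<Omega>" "C1_boundary_with_normal \<Omega> \<nu>" "GammaN \<Omega> A \<noteq> {} \<Longrightarrow> convex \<Omega>"
    and u: "continuous_on (\<Omega> \<union> GammaN \<Omega> A) u" "visc_subsolution \<Omega> A \<nu> \<beta> h u"
    and z: "z \<in> \<Omega>" and R: "0 < R"
    and sub: "cball z R \<inter> closure \<Omega> \<subseteq> \<Omega> \<union> GammaN \<Omega> A"
    and h: "\<And>w. w \<in> cball z R \<inter> closure \<Omega> \<Longrightarrow> h w \<le> h0"
    and M: "\<And>w. w \<in> cball z R \<inter> closure \<Omega> \<Longrightarrow> u w \<le> M"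
    and H: "h0 < H" and \<sigma>: "0 < \<sigma>"
    and MR: "M \<le> u z + \<sigma> * exp_profile \<beta> R - H * exp_profile_int \<beta> R"
    and r: "r \<le> R" and w: "w \<in> cball z r \<inter> closure \<Omega>"
  shows "u w \<le> u z + \<sigma> * exp_profile \<beta> r - H * exp_profile_int \<beta> r"
proof -
  define g where "g t = u z + \<sigma> * exp_profile \<beta> t - H * exp_profile_int \<beta> t" for t
  define k where "k t = \<sigma> - H * exp_profile (- \<beta>) t" for t
  define g1 where "g1 t = \<sigma> * exp (- (\<beta> * t)) - H * exp_profile \<beta> t" for t
  define g2 where "g2 t = - \<beta> * \<sigma> * exp (- (\<beta> * t)) - H * exp (- (\<beta> * t))" for t
  have dg: "(g has_real_derivative g1 t) (at t)" for t
    unfolding g_def g1_def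
    by (auto intro!: derivative_eq_intros exp_profile_has_derivative exp_profile_int_has_derivative)
  have dg1: "(g1 has_real_derivative g2 t) (at t)" for t
    unfolding g1_def g2_def
    by (auto intro!: derivative_eq_intros exp_profile_has_derivative)
  have g1k: "g1 t = exp (- (\<beta> * t)) * k t" for t
    unfolding g1_def k_def exp_profile_uminus[of \<beta>] by (simp add: algebra_simps)
  have ode: "- g2 t - \<beta> * g1 t = H" for t
  proof -
    have "- g2 t - \<beta> * g1 t = H * (exp (- (\<beta> * t)) + \<beta> * exp_profile \<beta> t)"
      by (simp add: g1_def g2_def algebra_simps)
    then show ?thesis by (simp add: mult_exp_profile)
  qed
  have k0: "k 0 = \<sigma>" by (simp add: k_def)
  \<comment> \<open>\<open>k\<close> has the sign of \<open>g1\<close> and is monotone in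
    \<open>t\<close>. If \<open>H > 0\<close> and \<open>k R < 0\<close> it decreases strictly
    through a single zero, taken as \<open>\<rho>\<close>; in all other cases it is positive before
    \<open>R\<close>, and \<open>\<rho> = R\<close>.\<close>
  obtain \<rho> where \<rho>: "0 < \<rho>" "\<rho> \<le> R" "\<And>t. 0 \<le> t \<Longrightarrow> t < \<rho> \<Longrightarrow> 0 < k t"
    "\<And>t. \<rho> < R \<Longrightarrow> \<rho> \<le> t \<Longrightarrow> k t \<le> 0" "0 \<le> k \<rho>"
  proof (cases "0 < H \<and> k R < 0")
    case False
    have "0 < k t" if "0 \<le> t" "t < R" for t
    proof (cases "H \<le> 0")
      case True
      have "0 \<le> exp_profile (- \<beta>) t" using exp_profile_pos[of t "- \<beta>"] that by (cases "t = 0") auto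
      with True \<sigma> show ?thesis unfolding k_def by (smt (verit) mult_nonpos_nonneg)
    next
      case H': False
      then have "k R < k t" using exp_profile_less[of t R "- \<beta>"] that by (simp add: k_def)
      then show ?thesis using False H' by simp
    qed
    moreover have "0 \<le> k R"
    proof (cases "H \<le> 0")
      case True
      then show ?thesis unfolding k_def using exp_profile_pos[OF R, of "- \<beta>"] \<sigma>
        by (smt (verit) mult_nonpos_nonneg)
    qed (use False in auto)
    ultimately show ?thesis using R by (intro that[of R]) auto
  next
    case True
    have "\<exists>\<rho>\<ge>0. \<rho> \<le> R \<and> k \<rho> = 0"
      using R \<sigma> True k0 unfolding k_def
      by (intro IVT2) (auto intro!: continuous_intros isCont_exp_profile)
    then obtain \<rho> where \<rho>: "0 \<le> \<rho>" "\<rho> \<le> R" "k \<rho> = 0" by blast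
    have dec: "k t < k s" if "s < t" for s t
      using exp_profile_less[OF that, of "- \<beta>"] True by (simp add: k_def)
    show ?thesis
    proof (rule that[of \<rho>])
      show "0 < \<rho>" using \<rho> k0 \<sigma> by (cases "\<rho> = 0") auto
      show "0 < k t" if "t < \<rho>" for t using dec[OF that] \<rho> by simp
      show "k t \<le> 0" if "\<rho> \<le> t" for t using dec[of \<rho> t] \<rho> that by (cases "t = \<rho>") auto
    qed (use \<rho> in auto)
  qed
  have mono: "g s \<le> g t" if "0 \<le> s" "s \<le> t" "t \<le> \<rho>" for s t
  proof (rule DERIV_nonneg_imp_nondecreasing[OF that(2)])
    fix x assume "s \<le> x" "x \<le> t"
    then have "0 \<le> k x" using \<rho>(3)[of x] \<rho>(5) that by (cases "x = \<rho>") auto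
    then show "\<exists>y. (g has_real_derivative y) (at x) \<and> 0 \<le> y"
      using dg[of x] by (auto simp: g1k)
  qed
  have anti: "g t \<le> g s" if "\<rho> \<le> s" "s \<le> t" "t \<le> R" for s t
  proof (cases "s = t")
    case False
    have "\<exists>y. (g has_real_derivative y) (at x) \<and> y \<le> 0" if "s \<le> x" for x
      using \<rho>(4)[of x] dg[of x] \<open>\<rho> \<le> s\<close> \<open>s \<le> t\<close> \<open>t \<le> R\<close> that False by (auto simp: g1k mult_le_0_iff)
    then show ?thesis using DERIV_nonpos_imp_nonincreasing[OF that(2)] by blast
  qed simp
  have M\<rho>: "M \<le> g \<rho>" using anti[of \<rho> R] \<rho> MR by (simp add: g_def)
  have wR: "w \<in> cball z R \<inter> closure \<Omega>" using w r by auto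
  show ?thesis
  proof (cases "r \<le> \<rho>")
    case True
    have sub': "cball z \<rho> \<subseteq> cball z R" using \<rho> by auto
    have "u w \<le> g (norm (w - z))"
    proof (rule radial_comparison[OF om u z \<open>0 < \<rho>\<close>, where ?g1.0 = g1 and ?g2.0 = g2 and ?h0.0 = h0])
      show "cball z \<rho> \<inter> closure \<Omega> \<subseteq> \<Omega> \<union> GammaN \<Omega> A" using sub sub' by blast
      show "u z \<le> g 0" by (simp add: g_def)
      show "0 < g1 t" if "0 < t" "t < \<rho>" for t using \<rho> that by (simp add: g1k)
      show "u y \<le> g \<rho>" if "y \<in> cball z \<rho> \<inter> closure \<Omega>" for y
        using M[of y] M\<rho> that sub' by auto
      show "w \<in> cball z \<rho> \<inter> closure \<Omega>" using w True by auto
    qed (use h sub' dg dg1 ode H in auto)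
    also have "\<dots> \<le> g r"
      using w True by (intro mono) (auto simp: dist_norm norm_minus_commute)
    finally show ?thesis by (simp add: g_def)
  next
    case False
    \<comment> \<open>Beyond \<open>\<rho>\<close> the profile decreases, so the trivial bound by
      \<open>M\<close> is enough.\<close>
    have "u w \<le> g R" using M[OF wR] MR by (simp add: g_def)
    also have "\<dots> \<le> g r" using False r by (intro anti) auto
    finally show ?thesis by (simp add: g_def)
  qed
qed

section \<open>Upper bounds from the value at the pole and the maximum on the ball\<close>

text \<open>Ensures that the slope which makes the profile reach \<open>M\<close> at radius
  \<open>R\<close> is positive, as \<open>profile_comparison\<close> requires. For
  \<open>H > 0\<close> this follows from \<open>u z \<le> M\<close>; for \<open>H < 0\<close> the
  subsolution property at \<open>z\<close> is needed.\<close>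

lemma two_point_slope_pos:
  fixes \<Omega> A :: "'a::euclidean_space set"
  assumes om: "open \<Omega>" "C1_boundary_with_normal \<Omega> \<nu>" "GammaN \<Omega> A \<noteq> {} \<Longrightarrow> convex \<Omega>"
    and u: "continuous_on (\<Omega> \<union> GammaN \<Omega> A) u" "visc_subsolution \<Omega> A \<nu> \<beta> h u"
    and z: "z \<in> \<Omega>" and R: "0 < R"
    and sub: "cball z R \<inter> closure \<Omega> \<subseteq> \<Omega> \<union> GammaN \<Omega> A"
    and h: "\<And>w. w \<in> cball z R \<inter> closure \<Omega> \<Longrightarrow> h w \<le> h0"
    and M: "\<And>w. w \<in> cball z R \<inter> closure \<Omega> \<Longrightarrow> u w \<le> M"
    and H: "h0 < H" "H \<noteq> 0" "h0 < 0 \<Longrightarrow> H < 0"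
  shows "0 < M - u z + H * exp_profile_int \<beta> R"
proof (cases "0 < H")
  case True
  have "z \<in> cball z R \<inter> closure \<Omega>" using z R closure_subset by auto
  from M[OF this] show ?thesis
    using True exp_profile_int_pos[OF R, of \<beta>] by (simp add: add_nonneg_pos)
next
  case False
  then have H0: "H < 0" using H by simp
  show ?thesis
  proof (rule ccontr)
    \<comment> \<open>With slope \<open>0\<close> at the pole the comparison function touches \<open>u\<close> at \<open>z\<close> itself.\<close>
    assume "\<not> ?thesis"
    then have small: "M \<le> u z - H * exp_profile_int \<beta> R" by simp
    \<comment> \<open>Slope 0 is not admissible in \<open>profile_comparison\<close>, so it is
      reached as the limit of slopes \<open>s > 0\<close>.\<close>
    have le: "u w \<le> u z - H * exp_profile_int \<beta> (norm (w - z))"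
      if w: "w \<in> cball z R \<inter> closure \<Omega>" for w
    proof (rule tendsto_lowerbound)
      let ?r = "norm (w - z)"
      show "((\<lambda>s. u z + s * exp_profile \<beta> ?r - H * exp_profile_int \<beta> ?r)
          \<longlongrightarrow> u z - H * exp_profile_int \<beta> ?r) (at_right 0)"
        by (auto intro!: tendsto_eq_intros)
      have "u w \<le> u z + s * exp_profile \<beta> ?r - H * exp_profile_int \<beta> ?r" if "s > 0" for s
      proof (rule profile_comparison[OF om u z R sub h M H(1) that])
        show "M \<le> u z + s * exp_profile \<beta> R - H * exp_profile_int \<beta> R"
          using small exp_profile_pos[OF R, of \<beta>] that by (smt (verit) mult_pos_pos)
      qed (use w in \<open>auto simp: dist_norm norm_minus_commute\<close>)
      then show "\<forall>\<^sub>F s in at_right 0. u w \<le> u z + s * exp_profile \<beta> ?r - H * exp_profile_int \<beta> ?r"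
        by (auto simp: eventually_at_filter)
    qed simp
    \<comment> \<open>The second derivative \<open>2 * b\<close> is the midpoint of
      \<open>- H\<close> and \<open>- h0\<close>: large enough to dominate
      \<open>- H * exp_profile_int\<close> near the pole, small enough to contradict
      \<open>h z \<le> h0\<close>.\<close>
    define b where "b = - (h0 + H) / 4"
    define p where "p t = b * t\<^sup>2 + H * exp_profile_int \<beta> t" for t
    define p1 where "p1 t = 2 * b * t + H * exp_profile \<beta> t" for t
    have "(p has_real_derivative p1 t) (at t)" for t
      unfolding p_def p1_def
      by (auto intro!: derivative_eq_intros exp_profile_int_has_derivative)
    moreover have "(p1 has_real_derivative (H - h0) / 2) (at 0)"
      unfolding p1_def b_def
      by (auto intro!: derivative_eq_intros exp_profile_has_derivative simp: field_simps)
    moreover have "p1 0 = 0" by (simp add: p1_def)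
    ultimately obtain e where e: "e > 0" "\<And>t. \<bar>t\<bar> < e \<Longrightarrow> 0 \<le> p t"
      using second_derivative_local_min[of 1 0 p p1 "(H - h0) / 2"] H by (auto simp: p_def)
    let ?\<phi> = "radial_quartic z 0 b 0"
    obtain d where d: "d > 0" "ball z d \<subseteq> \<Omega>" using om(1) z open_contains_ball by blast
    have "u y - ?\<phi> y \<le> u z - ?\<phi> z"
      if "y \<in> (\<Omega> \<union> GammaN \<Omega> A) \<inter> ball z (min d (min e R))" for y
    proof -
      have y: "y \<in> cball z R \<inter> closure \<Omega>" "norm (y - z) < e"
        using that d closure_subset[of \<Omega>]
        by (auto simp: GammaN_def frontier_def dist_norm norm_minus_commute)
      then show ?thesis
        using le[OF y(1)] e(2)[of "norm (y - z)"] by (simp add: p_def radial_quartic_def)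
    qed
    moreover have "min d (min e R) > 0" using d e R by simp
    moreover have "z \<notin> GammaN \<Omega> A" using om(1) z by (auto simp: GammaN_def frontier_def interior_open)
    ultimately have "- inf_lap_plus ?\<phi> z - \<beta> * norm (grad ?\<phi> z) \<le> h z"
      using u(2) z C2_closure_radial_quartic[of \<Omega> z 0 b 0]
      unfolding visc_subsolution_def by blast
    moreover have "h z \<le> h0" using z R closure_subset by (intro h) auto
    ultimately show False
      using H(1) unfolding inf_lap_plus_quadratic grad_radial_quartic b_def
      by (simp add: field_simps)
  qed
qed

text \<open>The comparison holds for constants \<open>H > h0\<close>, with the slope fitted to
  \<open>M\<close> at radius \<open>R\<close>; letting \<open>H\<close> decrease to
  \<open>h0\<close> removes the strictness. Values \<open>H = 0\<close> are avoided on the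
  way.\<close>

lemma two_point_comparison:
  fixes \<Omega> A :: "'a::euclidean_space set"
  assumes om: "open \<Omega>" "C1_boundary_with_normal \<Omega> \<nu>" "GammaN \<Omega> A \<noteq> {} \<Longrightarrow> convex \<Omega>"
    and u: "continuous_on (\<Omega> \<union> GammaN \<Omega> A) u" "visc_subsolution \<Omega> A \<nu> \<beta> h u"
    and z: "z \<in> \<Omega>" and R: "0 < R"
    and sub: "cball z R \<inter> closure \<Omega> \<subseteq> \<Omega> \<union> GammaN \<Omega> A"
    and h: "\<And>w. w \<in> cball z R \<inter> closure \<Omega> \<Longrightarrow> h w \<le> h0"
    and M: "\<And>w. w \<in> cball z R \<inter> closure \<Omega> \<Longrightarrow> u w \<le> M"
    and r: "r \<le> R" and w: "w \<in> cball z r \<inter> closure \<Omega>"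
  shows "u w \<le> u z + (M - u z + h0 * exp_profile_int \<beta> R) / exp_profile \<beta> R * exp_profile \<beta> r
           - h0 * exp_profile_int \<beta> r"
proof (rule tendsto_lowerbound)
  let ?\<sigma> = "\<lambda>H. (M - u z + H * exp_profile_int \<beta> R) / exp_profile \<beta> R"
  let ?G = "\<lambda>H. u z + ?\<sigma> H * exp_profile \<beta> r - H * exp_profile_int \<beta> r"
  have E: "exp_profile \<beta> R > 0" using R by (rule exp_profile_pos)
  show "(?G \<longlongrightarrow> ?G h0) (at_right h0)"
    using E by (auto intro!: tendsto_intros)
  have "u w \<le> ?G H" if "h0 < H" "H \<noteq> 0" "h0 < 0 \<Longrightarrow> H < 0" for H
  proof (rule profile_comparison[OF om u z R sub h M that(1)])
    show "0 < ?\<sigma> H"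
      using two_point_slope_pos[OF om u z R sub h M that] E by simp
  qed (use E r w in auto)
  moreover have "\<forall>\<^sub>F H in at_right h0. h0 < H \<and> H \<noteq> 0 \<and> (h0 < 0 \<longrightarrow> H < 0)"
  proof (cases "h0 < 0")
    case True
    then show ?thesis by (auto simp: eventually_at_right intro!: exI[of _ 0])
  next
    case False
    then show ?thesis by (auto simp: eventually_at_filter)
  qed
  ultimately show "\<forall>\<^sub>F H in at_right h0. u w \<le> ?G H"
    by (auto elim!: eventually_mono)
qed simp

text \<open>A pole on the boundary lacks the strict sign from \<open>convex_normal_pos\<close>, so
  \<open>x\<close> is approximated by interior poles \<open>z n\<close>, using continuity of
  \<open>u\<close> at \<open>x\<close>.\<close>

lemma two_point_comparison_closure:
  fixes \<Omega> A :: "'a::euclidean_space set"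
  assumes om: "open \<Omega>" "C1_boundary_with_normal \<Omega> \<nu>" "GammaN \<Omega> A \<noteq> {} \<Longrightarrow> convex \<Omega>"
    and u: "continuous_on (\<Omega> \<union> GammaN \<Omega> A) u" "visc_subsolution \<Omega> A \<nu> \<beta> h u"
    and x: "x \<in> closure \<Omega>" and r: "0 < r" "r < R"
    and sub: "cball x R \<inter> closure \<Omega> \<subseteq> \<Omega> \<union> GammaN \<Omega> A"
    and h: "\<And>w. w \<in> cball x R \<inter> closure \<Omega> \<Longrightarrow> h w \<le> h0"
    and M: "\<And>w. w \<in> cball x R \<inter> closure \<Omega> \<Longrightarrow> u w \<le> M"
    and w: "w \<in> cball x r \<inter> closure \<Omega>"
  shows "u w \<le> u x + (M - u x + h0 * exp_profile_int \<beta> R) / exp_profile \<beta> R * exp_profile \<beta> r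
           - h0 * exp_profile_int \<beta> r"
proof -
  obtain z where z: "\<And>n. z n \<in> \<Omega>" "z \<longlonglongrightarrow> x"
    using x unfolding closure_sequential by blast
  define d where "d n = dist (z n) x" for n
  have d: "d \<longlonglongrightarrow> 0" using tendsto_dist_iff[THEN iffD1, OF z(2)] unfolding d_def .
  have xS: "x \<in> \<Omega> \<union> GammaN \<Omega> A" using x sub r by (intro subsetD[OF sub]) auto
  have uz: "(\<lambda>n. u (z n)) \<longlonglongrightarrow> u x"
    using continuous_on_tendsto_compose[OF u(1) z(2) xS] z(1) by simp
  have dR: "(\<lambda>n. R - d n) \<longlonglongrightarrow> R" and dr: "(\<lambda>n. r + d n) \<longlonglongrightarrow> r"
    using d by (auto intro!: tendsto_eq_intros)
  have E: "exp_profile \<beta> R > 0" using r by (intro exp_profile_pos) auto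
  \<comment> \<open>The outer radius shrinks by \<open>d n\<close> so that the ball about
    \<open>z n\<close> stays in \<open>cball x R\<close>; the inner one grows by \<open>d n\<close>
    so that it covers \<open>cball x r\<close>. As \<open>r < R\<close>, they stay ordered once
    \<open>d n < (R - r) / 2\<close>.\<close>
  let ?G = "\<lambda>n. u (z n) + (M - u (z n) + h0 * exp_profile_int \<beta> (R - d n)) / exp_profile \<beta> (R - d n)
     * exp_profile \<beta> (r + d n) - h0 * exp_profile_int \<beta> (r + d n)"
  show ?thesis
  proof (rule tendsto_lowerbound)
    show "?G \<longlonglongrightarrow> u x + (M - u x + h0 * exp_profile_int \<beta> R) / exp_profile \<beta> R * exp_profile \<beta> r
           - h0 * exp_profile_int \<beta> r"
      using E by (intro tendsto_intros uz isCont_tendsto_compose[OF isCont_exp_profile(1)]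
          isCont_tendsto_compose[OF isCont_exp_profile(2)] dR dr) auto
    have "\<forall>\<^sub>F n in sequentially. d n < (R - r) / 2"
      using d r by (intro order_tendstoD(2)) auto
    then show "\<forall>\<^sub>F n in sequentially. u w \<le> ?G n"
    proof (rule eventually_mono)
      fix n assume n: "d n < (R - r) / 2"
      have "cball (z n) (R - d n) \<subseteq> cball x R"
        unfolding d_def by (simp add: cball_subset_cball_iff)
      then have *: "cball (z n) (R - d n) \<inter> closure \<Omega> \<subseteq> cball x R \<inter> closure \<Omega>" by blast
      have "d n \<ge> 0" by (simp add: d_def)
      show "u w \<le> ?G n"
      proof (rule two_point_comparison[OF om u z(1)])
        show "w \<in> cball (z n) (r + d n) \<inter> closure \<Omega>"
          using w dist_triangle[of "z n" w x] by (auto simp: d_def)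
        show "0 < R - d n" "r + d n \<le> R - d n" using n \<open>d n \<ge> 0\<close> r by auto
      qed (use * sub h M in blast)+
    qed
  qed simp
qed

section \<open>Coefficient and doubling identities\<close>

lemma a_minus_exp_profile: "a_minus \<epsilon> \<beta> = 1 / exp_profile \<beta> \<epsilon>"
  by (simp add: a_minus_def exp_profile_def mult.commute)

lemma a_plus_exp_profile: "a_plus \<epsilon> \<beta> = exp (- (\<beta> * \<epsilon>)) / exp_profile \<beta> \<epsilon>"
  unfolding exp_profile_uminus[of \<beta> \<epsilon>]
  by (simp add: a_plus_def exp_profile_def mult.commute) (metis minus_diff_eq minus_divide_right)

lemma exp_profile_double:
  "exp_profile \<beta> (2 * r) = (1 + exp (- (\<beta> * r))) * exp_profile \<beta> r"
proof -
  have "exp (- (\<beta> * (2 * r))) = exp (- (\<beta> * r)) * exp (- (\<beta> * r))"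
    by (simp flip: exp_add)
  then show ?thesis by (simp add: exp_profile_def field_simps)
qed

text \<open>With \<open>exp_profile_double\<close>, this collapses the \<open>h0\<close> terms of
  the two-point bound at radii \<open>\<epsilon>\<close> and \<open>2 * \<epsilon>\<close> to a
  multiple of \<open>\<epsilon> * exp_profile \<beta> \<epsilon>\<close>. For nonzero
  \<open>\<beta>\<close> it is checked after multiplication by \<open>\<beta>\<close>.\<close>

lemma exp_profile_int_double:
  "exp_profile_int \<beta> (2 * r) =
     (1 + exp (- (\<beta> * r))) * exp_profile_int \<beta> r + r * exp_profile \<beta> r"
proof (cases "\<beta> = 0")
  case False
  then have "\<beta> * exp_profile_int \<beta> t = t - exp_profile \<beta> t" for t
    by (simp add: exp_profile_int_def)
  then have "\<beta> * exp_profile_int \<beta> (2 * r) = 2 * r - (1 + exp (- (\<beta> * r))) * exp_profile \<beta> r"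
    "\<beta> * exp_profile_int \<beta> r = r - exp_profile \<beta> r"
    by (simp_all add: exp_profile_double)
  then have "\<beta> * exp_profile_int \<beta> (2 * r) =
      \<beta> * ((1 + exp (- (\<beta> * r))) * exp_profile_int \<beta> r + r * exp_profile \<beta> r)"
    using mult_exp_profile[of \<beta> r] by algebra
  then show ?thesis using False by simp
qed (simp add: exp_profile_def exp_profile_int_def power2_eq_square)

section \<open>Boundedness of upper semicontinuous functions\<close>

text \<open>Near each \<open>x\<close> the function stays below \<open>h x + 1\<close>, and a finite
  subcover suffices. The bound makes the real supremum in \<open>sup_eps\<close> an actual upper
  bound for \<open>h\<close>.\<close>

lemma usc_on_bdd_above_compact:
  fixes h :: "'a::metric_space \<Rightarrow> real"
  assumes "usc_on S h" "compact C" "C \<subseteq> S"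
  shows "bdd_above (h ` C)"
proof -
  have "\<exists>U. open U \<and> x \<in> U \<and> (\<forall>y\<in>U \<inter> C. h y \<le> h x + 1)" if x: "x \<in> C" for x
  proof -
    have "\<forall>\<^sub>F y in at x within S. h y < h x + 1"
      using assms x by (auto simp: usc_on_def)
    then obtain U where "open U" "x \<in> U" "\<forall>y\<in>U. y \<noteq> x \<longrightarrow> y \<in> S \<longrightarrow> h y < h x + 1"
      unfolding eventually_at_topological by blast
    then have "\<forall>y\<in>U \<inter> C. h y \<le> h x + 1" using assms(3)
      by (metis IntE less_add_one less_eq_real_def subsetD)
    with \<open>open U\<close> \<open>x \<in> U\<close> show ?thesis by blast
  qed
  then obtain U where U: "\<And>x. x \<in> C \<Longrightarrow> open (U x) \<and> x \<in> U x \<and> (\<forall>y\<in>U x \<inter> C. h y \<le> h x + 1)"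
    by metis
  obtain D where D: "D \<subseteq> C" "finite D" "C \<subseteq> (\<Union>x\<in>D. U x)"
    using compactE_image[OF assms(2), of C U] U by blast
  show ?thesis
  proof (intro bdd_aboveI2)
    fix y assume "y \<in> C"
    then obtain x where x: "x \<in> D" "y \<in> U x" using D by blast
    then have "h y \<le> h x + 1" using U D \<open>y \<in> C\<close> by blast
    also have "\<dots> \<le> Max (h ` D) + 1" using x D by simp
    finally show "h y \<le> Max (h ` D) + 1" .
  qed
qed

section \<open>The finite difference inequality\<close>

theorem theorem2p2:
  fixes \<Omega> A :: "'a::euclidean_space set" and \<nu> :: "'a \<Rightarrow> 'a" and \<beta> :: real
    and h u :: "'a \<Rightarrow> real"
  assumes "bounded \<Omega>" and "open \<Omega>" and "connected \<Omega>"
    and "C1_boundary_with_normal \<Omega> \<nu>"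
    and "open A"
    and "GammaD \<Omega> A \<noteq> {}"
    and "GammaN \<Omega> A \<noteq> {} \<Longrightarrow> convex \<Omega>"
    and "usc_on (\<Omega> \<union> GammaN \<Omega> A) h"
    and "continuous_on (\<Omega> \<union> GammaN \<Omega> A) u"
    and "visc_subsolution \<Omega> A \<nu> \<beta> h u"
  shows "\<forall>\<epsilon>>0. \<forall>x\<in>Omega_eps \<Omega> A (2 * \<epsilon>).
           a_plus \<epsilon> \<beta> * S_minus \<Omega> \<epsilon> (sup_eps \<Omega> \<epsilon> u) x
             - a_minus \<epsilon> \<beta> * S_plus \<Omega> \<epsilon> (sup_eps \<Omega> \<epsilon> u) x
           \<le> sup_eps \<Omega> (2 * \<epsilon>) h x"
proof (intro allI impI ballI)
  fix \<epsilon> :: real and x assume e: "0 < \<epsilon>" and "x \<in> Omega_eps \<Omega> A (2 * \<epsilon>)"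
  then have x: "x \<in> closure \<Omega>" and far: "infdist x (GammaD \<Omega> A) > 2 * \<epsilon>"
    by (auto simp: Omega_eps_def)
  let ?C = "cball x (2 * \<epsilon>) \<inter> closure \<Omega>"
  have disj: "y \<notin> GammaD \<Omega> A" if "y \<in> cball x (2 * \<epsilon>)" for y
    using infdist_le[of y "GammaD \<Omega> A" x] far that by auto
  have fr: "frontier \<Omega> = closure \<Omega> - \<Omega>" using \<open>open \<Omega>\<close> by (simp add: frontier_def interior_open)
  have sub: "?C \<subseteq> \<Omega> \<union> GammaN \<Omega> A"
    using disj unfolding GammaD_def GammaN_def fr by blast
  \<comment> \<open>Without a Neumann part the ball misses the whole boundary and, being connected,
    lies in the open set, so \<open>?C\<close> is the ball itself.\<close>
  have cvx: "convex ?C"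
  proof (cases "GammaN \<Omega> A = {}")
    case False
    then show ?thesis using assms(7) by (intro convex_Int convex_cball convex_closure)
  next
    case True
    then have away: "cball x (2 * \<epsilon>) \<inter> frontier \<Omega> = {}"
      using disj unfolding GammaD_def GammaN_def by blast
    moreover have "x \<in> cball x (2 * \<epsilon>)" using e by simp
    ultimately have "x \<in> cball x (2 * \<epsilon>) \<inter> \<Omega>"
      using x unfolding fr by blast
    then have "cball x (2 * \<epsilon>) \<subseteq> \<Omega>"
      using connected_Int_frontier[of "cball x (2 * \<epsilon>)" \<Omega>] away
        convex_connected[OF convex_cball] by blast
    then show ?thesis using closure_subset by (metis Int_absorb2 convex_cball order_trans)
  qed
  have comp: "compact ?C" by (simp add: compact_Int_closed)
  have bdu: "bdd_above (u ` ?C)"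
    by (intro bounded_imp_bdd_above compact_imp_bounded compact_continuous_image comp
        continuous_on_subset[OF assms(9) sub])
  have bdh: "bdd_above (h ` ?C)"
    using usc_on_bdd_above_compact[OF assms(8) comp sub] .
  define M where "M = (SUP y\<in>?C. u y)"
  define h0 where "h0 = sup_eps \<Omega> (2 * \<epsilon>) h x"
  have M: "u y \<le> M" if "y \<in> ?C" for y unfolding M_def by (rule cSUP_upper[OF that bdu])
  have h0: "h y \<le> h0" if "y \<in> ?C" for y
    unfolding h0_def sup_eps_def by (rule cSUP_upper[OF that bdh])
  have sub1: "cball y \<epsilon> \<inter> closure \<Omega> \<subseteq> ?C" if "y \<in> cball x \<epsilon> \<inter> closure \<Omega>" for y
  proof -
    have "cball y \<epsilon> \<subseteq> cball x (2 * \<epsilon>)" using that by (auto simp: cball_subset_cball_iff dist_commute)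
    then show ?thesis by blast
  qed
  have upper: "u w \<le> sup_eps \<Omega> \<epsilon> u y"
    if "y \<in> cball x \<epsilon> \<inter> closure \<Omega>" "w \<in> cball y \<epsilon> \<inter> closure \<Omega>" for y w
    unfolding sup_eps_def using that(2) bdd_above_mono[OF bdu image_mono[OF sub1[OF that(1)]]]
    by (rule cSUP_upper)
  \<comment> \<open>This bound also makes the outer supremum in \<open>sup\<close> well
    behaved.\<close>
  have le_M: "sup_eps \<Omega> \<epsilon> u y \<le> M" if y: "y \<in> cball x \<epsilon> \<inter> closure \<Omega>" for y
    unfolding sup_eps_def
  proof (rule cSUP_least)
    have "y \<in> cball y \<epsilon> \<inter> closure \<Omega>" using y e by simp
    then show "cball y \<epsilon> \<inter> closure \<Omega> \<noteq> {}" by blast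
  qed (use M sub1[OF y] in blast)
  have x1: "x \<in> cball x \<epsilon> \<inter> closure \<Omega>" using x e by auto
  have inf: "u x \<le> inf_eps \<Omega> \<epsilon> (sup_eps \<Omega> \<epsilon> u) x"
    unfolding inf_eps_def
  proof (rule cINF_greatest)
    fix y assume "y \<in> cball x \<epsilon> \<inter> closure \<Omega>"
    then show "u x \<le> sup_eps \<Omega> \<epsilon> u y" using x by (intro upper) (auto simp: dist_commute)
  qed (use x1 in blast)
  have sup: "M \<le> sup_eps \<Omega> \<epsilon> (sup_eps \<Omega> \<epsilon> u) x"
    unfolding M_def
  proof (rule cSUP_least)
    have xC: "x \<in> ?C" using x e by simp
    then show "?C \<noteq> {}" by blast
    fix w assume w: "w \<in> ?C"
    \<comment> \<open>The midpoint is within \<open>\<epsilon>\<close> of both \<open>x\<close> and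
      \<open>w\<close>, and convexity of \<open>?C\<close> keeps it in the closure.\<close>
    define y where "y = midpoint x w"
    have "y \<in> closed_segment x w" by (simp add: y_def)
    then have "y \<in> ?C"
      using cvx xC w unfolding convex_contains_segment by blast
    then have y: "y \<in> cball x \<epsilon> \<inter> closure \<Omega>" using w by (auto simp: y_def dist_midpoint)
    have "u w \<le> sup_eps \<Omega> \<epsilon> u y"
      using w by (intro upper[OF y]) (auto simp: y_def dist_midpoint)
    also have "\<dots> \<le> sup_eps \<Omega> \<epsilon> (sup_eps \<Omega> \<epsilon> u) x"
      unfolding sup_eps_def[of \<Omega> \<epsilon> "sup_eps \<Omega> \<epsilon> u"]
      by (intro cSUP_upper y bdd_aboveI2[of _ _ M] le_M)
    finally show "u w \<le> sup_eps \<Omega> \<epsilon> (sup_eps \<Omega> \<epsilon> u) x" .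
  qed
  define E where "E = exp_profile \<beta> \<epsilon>"
  define q where "q = exp (- (\<beta> * \<epsilon>))"
  have E: "E > 0" unfolding E_def using e by (rule exp_profile_pos)
  have q: "q > 0" by (simp add: q_def)
  have "sup_eps \<Omega> \<epsilon> u x \<le> u x + (M - u x + h0 * exp_profile_int \<beta> (2 * \<epsilon>)) / exp_profile \<beta> (2 * \<epsilon>)
      * exp_profile \<beta> \<epsilon> - h0 * exp_profile_int \<beta> \<epsilon>"
    unfolding sup_eps_def
  proof (rule cSUP_least)
    fix w assume w: "w \<in> cball x \<epsilon> \<inter> closure \<Omega>"
    show "u w \<le> u x + (M - u x + h0 * exp_profile_int \<beta> (2 * \<epsilon>)) / exp_profile \<beta> (2 * \<epsilon>)
      * exp_profile \<beta> \<epsilon> - h0 * exp_profile_int \<beta> \<epsilon>"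
      by (rule two_point_comparison_closure[OF assms(2,4,7,9,10) x e _ sub h0 M w]) (use e in auto)
  qed (use x1 in blast)
  \<comment> \<open>Doubling gives
    \<open>E / exp_profile \<beta> (2 * \<epsilon>) = 1 / (1 + q)\<close>, so \<open>u x\<close> and
    \<open>M\<close> receive the weights \<open>q / (1 + q)\<close> and
    \<open>1 / (1 + q)\<close>.\<close>
  also have "\<dots> = (q * u x + M + h0 * (\<epsilon> * E)) / (1 + q)"
    using E q by (simp add: exp_profile_double exp_profile_int_double flip: E_def q_def)
      (simp add: divide_simps, simp add: algebra_simps)
  finally have key: "(1 + q) * sup_eps \<Omega> \<epsilon> u x \<le> q * u x + M + h0 * (\<epsilon> * E)"
    using q by (simp add: field_simps)
  let ?v = "sup_eps \<Omega> \<epsilon> u"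
  have "q * (?v x - inf_eps \<Omega> \<epsilon> ?v x) - (sup_eps \<Omega> \<epsilon> ?v x - ?v x) \<le> q * (?v x - u x) - (M - ?v x)"
    using inf sup q by (intro diff_mono mult_left_mono) auto
  also have "\<dots> \<le> h0 * (\<epsilon> * E)" using key by (simp add: algebra_simps)
  finally have main: "q * (?v x - inf_eps \<Omega> \<epsilon> ?v x) - (sup_eps \<Omega> \<epsilon> ?v x - ?v x) \<le> h0 * (\<epsilon> * E)" .
  \<comment> \<open>The coefficients are \<open>q / E\<close> and \<open>1 / E\<close>, which turns
    \<open>main\<close> into the claim after division by \<open>\<epsilon> * E\<close>.\<close>
  have "a_plus \<epsilon> \<beta> * S_minus \<Omega> \<epsilon> ?v x - a_minus \<epsilon> \<beta> * S_plus \<Omega> \<epsilon> ?v x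
      = (q * (?v x - inf_eps \<Omega> \<epsilon> ?v x) - (sup_eps \<Omega> \<epsilon> ?v x - ?v x)) / (\<epsilon> * E)"
    unfolding a_plus_exp_profile a_minus_exp_profile S_minus_def S_plus_def E_def[symmetric] q_def[symmetric]
    by (simp only: times_divide_times_eq mult_1 diff_divide_distrib[symmetric] mult.commute[of \<epsilon> E])
  also have "\<dots> \<le> h0"
    using main E e by (simp only: pos_divide_le_eq mult_pos_pos)
  finally show "a_plus \<epsilon> \<beta> * S_minus \<Omega> \<epsilon> ?v x - a_minus \<epsilon> \<beta> * S_plus \<Omega> \<epsilon> ?v x
           \<le> sup_eps \<Omega> (2 * \<epsilon>) h x"
    by (simp only: h0_def)
qed

end
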